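(* Let $(\mathfrak{g},\omega)$ be a nonzero finite dimensional symplectic Lie algebra over a field $\mathbb{K}$ of characteristic $0$. Then $(\mathfrak{g},\omega)$ is a symplectic Poisson algebra if and only if it is a symplectic double extension of a symplectic Poisson algebra $(\mathfrak{h},\overline{\omega})$ of dimension $\dim\mathfrak{g}-2$ by the one dimensional Lie algebra by means of an admissible element $(D,z)\in\mathrm{Der}(\mathfrak{h})\times\mathfrak{h}$.
   Context: A symplectic Lie algebra $(\mathfrak{g},\omega)$ is a Lie algebra with a nondegenerate skew-symmetric bilinear form $\omega$ such that $\omega([u,v],w)+\omega([v,w],u)+\omega([w,u],v)=0$ for all $u,v,w$. The adjoint $F^*$ of an endomorphism $F$ with respect to $\omega$ is defined by $\omega(Fu,v)=\omega(u,F^*v)$. A Lie algebra is 2-nilpotent if $[[u,v],w]=0$ for all $u,v,w$. A symplectic Poisson algebra is a 2-nilpotent symplectic Lie algebra $(\mathfrak{g},\omega)$ satisfying $[\mathrm{ad}_u,\mathrm{ad}_v^*]=0$ for all $u,v\in\mathfrak{g}$, the adjoint being taken with respect to $\omega$. (The zero algebra is allowed as $\mathfrak h$.) Let $(\mathfrak{h},[\,,\,]_{\mathfrak{h}},\overline{\omega})$ be a symplectic Lie algebra and $(D,z)\in\mathrm{Der}(\mathfrak{h})\times\mathfrak{h}$; let $D^*$ be the adjoint of $D$ with respect to $\overline{\omega}$. $(\mathfrak{g},[\,,\,]_{\mathfrak{g}},\omega)$ is the symplectic double extension of $(\mathfrak{h},\overline{\omega})$ by the one-dimensional Lie algebra by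 means of $(D,z)$ if (up to symplectic isomorphism of Lie algebras) $\mathfrak{g}=\mathbb{K}e\oplus\mathfrak{h}\oplus\mathbb{K}d$ with, for all $a,b\in\mathfrak{h}$, $$[a,b]_{\mathfrak{g}}=[a,b]_{\mathfrak{h}}+\overline{\omega}((D+D^* )(a),b)e,\quad [a,d]_{\mathfrak{g}}=D(a)+\overline{\omega}(z,a)e,\quad [d,d]_{\mathfrak{g}}=0,\quad [e,\mathfrak{g}]_{\mathfrak{g}}=\{0\},$$ and $\omega|_{\mathfrak{h}\times\mathfrak{h}}=\overline{\omega}$, $\omega(e,d)=1$, $\omega(e,\mathfrak{h})=\omega(d,\mathfrak{h})=\{0\}$. For a symplectic Poisson algebra $(\mathfrak{h},\overline{\omega})$ with center $Z(\mathfrak{h})$, an element $(D,z)\in\mathrm{Der}(\mathfrak{h})\times\mathfrak{h}$ is admissible if $D(\mathfrak{h})\subset Z(\mathfrak{h})$, $D^*(\mathfrak{h})\subset Z(\mathfrak{h})$, $D^2=D^*\circ D=D\circ D^*=0$, $D^*(z)=D(z)=0$ and $z\in Z(\mathfrak{h})$. *)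

theory Defs
  imports Complex_Main
begin

text \<open>
  Vector spaces are carried by subspaces of an ambient vector space given by the locale
  \<^locale>\<open>vector_space\<close>, so that spaces of different dimensions can occur in one statement.
  Brackets, forms and endomorphisms are total functions on the ambient type; only their values
  on the carrier matter. A double extension and the algebra \<open>H\<close> it is built from need not share
  an ambient space; but as \<open>H\<close> embeds in the extension, letting it range over subspaces of the
  ambient space of the extension covers every \<open>H\<close> up to isomorphism.
\<close>

definition linear_map_on ::
    "('k::field \<Rightarrow> 'a::ab_group_add \<Rightarrow> 'a) \<Rightarrow> ('k \<Rightarrow> 'b::ab_group_add \<Rightarrow> 'b)
      \<Rightarrow> 'a set \<Rightarrow> ('a \<Rightarrow> 'b) \<Rightarrow> bool" where
  "linear_map_on s t V f \<longleftrightarrow>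
     (\<forall>x\<in>V. \<forall>y\<in>V. f (x + y) = f x + f y) \<and> (\<forall>c. \<forall>x\<in>V. f (s c x) = t c (f x))"

definition finite_dimensional ::
    "('k::field \<Rightarrow> 'a::ab_group_add \<Rightarrow> 'a) \<Rightarrow> 'a set \<Rightarrow> bool" where
  "finite_dimensional s V \<longleftrightarrow> (\<exists>B. finite B \<and> module.span s B = V)"

locale lie_algebra = vector_space scale
  for scale :: "'k::field \<Rightarrow> 'a::ab_group_add \<Rightarrow> 'a" +
  fixes V :: "'a set" and br :: "'a \<Rightarrow> 'a \<Rightarrow> 'a"
  assumes carrier_subspace: "subspace V"
    and br_closed: "u \<in> V \<Longrightarrow> v \<in> V \<Longrightarrow> br u v \<in> V"
    and br_linear_right: "u \<in> V \<Longrightarrow> linear_map_on scale scale V (br u)"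
    and br_linear_left: "v \<in> V \<Longrightarrow> linear_map_on scale scale V (\<lambda>u. br u v)"
    and br_alternating: "u \<in> V \<Longrightarrow> br u u = 0"
    and jacobi: "u \<in> V \<Longrightarrow> v \<in> V \<Longrightarrow> w \<in> V \<Longrightarrow>
      br (br u v) w + br (br v w) u + br (br w u) v = 0"

locale symplectic_lie_algebra = lie_algebra scale V br
  for scale :: "'k::field \<Rightarrow> 'a::ab_group_add \<Rightarrow> 'a"
    and V :: "'a set" and br :: "'a \<Rightarrow> 'a \<Rightarrow> 'a" +
  fixes \<omega> :: "'a \<Rightarrow> 'a \<Rightarrow> 'k"
  assumes form_linear_right: "u \<in> V \<Longrightarrow> linear_map_on scale (*) V (\<omega> u)"
    and form_linear_left: "v \<in> V \<Longrightarrow> linear_map_on scale (*) V (\<lambda>u. \<omega> u v)"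
    and form_skew: "u \<in> V \<Longrightarrow> v \<in> V \<Longrightarrow> \<omega> u v = - \<omega> v u"
    and form_nondegenerate: "u \<in> V \<Longrightarrow> (\<And>v. v \<in> V \<Longrightarrow> \<omega> u v = 0) \<Longrightarrow> u = 0"
    and form_closed: "u \<in> V \<Longrightarrow> v \<in> V \<Longrightarrow> w \<in> V \<Longrightarrow>
      \<omega> (br u v) w + \<omega> (br v w) u + \<omega> (br w u) v = 0"

text \<open>
  The adjoint of \<open>F\<close> with respect to \<open>\<omega>\<close>: the description is satisfied by at most one \<open>w\<close> if
  \<open>\<omega>\<close> is nondegenerate on \<open>V\<close>, and by exactly one if moreover \<open>V\<close> is finite dimensional and
  \<open>F\<close> is an endomorphism of \<open>V\<close>. Values outside \<open>V\<close> are meaningless.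
\<close>

definition form_adjoint ::
    "'a set \<Rightarrow> ('a \<Rightarrow> 'a \<Rightarrow> 'k) \<Rightarrow> ('a \<Rightarrow> 'a) \<Rightarrow> 'a \<Rightarrow> 'a" where
  "form_adjoint V \<omega> F v = (THE w. w \<in> V \<and> (\<forall>u\<in>V. \<omega> (F u) v = \<omega> u w))"

definition lie_center :: "'a::zero set \<Rightarrow> ('a \<Rightarrow> 'a \<Rightarrow> 'a) \<Rightarrow> 'a set" where
  "lie_center V br = {u \<in> V. \<forall>v\<in>V. br u v = 0}"

definition lie_derivation ::
    "('k::field \<Rightarrow> 'a::ab_group_add \<Rightarrow> 'a) \<Rightarrow> 'a set \<Rightarrow> ('a \<Rightarrow> 'a \<Rightarrow> 'a) \<Rightarrow> ('a \<Rightarrow> 'a) \<Rightarrow> bool"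
  where
  "lie_derivation s V br D \<longleftrightarrow>
     D ` V \<subseteq> V \<and> linear_map_on s s V D \<and>
     (\<forall>a\<in>V. \<forall>b\<in>V. D (br a b) = br (D a) b + br a (D b))"

locale symplectic_poisson_algebra = symplectic_lie_algebra +
  assumes two_nilpotent: "u \<in> V \<Longrightarrow> v \<in> V \<Longrightarrow> w \<in> V \<Longrightarrow> br (br u v) w = 0"
    and ad_commutes_adjoint: "u \<in> V \<Longrightarrow> v \<in> V \<Longrightarrow> w \<in> V \<Longrightarrow>
      br u (form_adjoint V \<omega> (br v) w) = form_adjoint V \<omega> (br v) (br u w)"

definition admissible ::
    "('k::field \<Rightarrow> 'a::ab_group_add \<Rightarrow> 'a) \<Rightarrow> 'a set \<Rightarrow> ('a \<Rightarrow> 'a \<Rightarrow> 'a) \<Rightarrow> ('a \<Rightarrow> 'a \<Rightarrow> 'k)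
      \<Rightarrow> ('a \<Rightarrow> 'a) \<Rightarrow> 'a \<Rightarrow> bool" where
  "admissible s H br \<omega> D z \<longleftrightarrow>
     lie_derivation s H br D \<and> z \<in> H \<and>
     (let Ds = form_adjoint H \<omega> D; Z = lie_center H br in
        D ` H \<subseteq> Z \<and> Ds ` H \<subseteq> Z \<and>
        (\<forall>a\<in>H. D (D a) = 0 \<and> Ds (D a) = 0 \<and> D (Ds a) = 0) \<and>
        Ds z = 0 \<and> D z = 0 \<and> z \<in> Z)"

text \<open>
  The map \<open>\<iota>\<close> is the inclusion of \<open>H\<close> in \<open>G\<close>. The bijection is the linear isomorphism of
  \<open>K e \<oplus> H \<oplus> K d\<close> with \<open>G\<close>, and the remaining equations say that it carries the
  prescribed bracket and form to those of \<open>G\<close>.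
\<close>

definition symplectic_double_extension ::
    "('k::field \<Rightarrow> 'a::ab_group_add \<Rightarrow> 'a) \<Rightarrow> 'a set \<Rightarrow> ('a \<Rightarrow> 'a \<Rightarrow> 'a) \<Rightarrow> ('a \<Rightarrow> 'a \<Rightarrow> 'k)
      \<Rightarrow> ('k \<Rightarrow> 'b::ab_group_add \<Rightarrow> 'b) \<Rightarrow> 'b set \<Rightarrow> ('b \<Rightarrow> 'b \<Rightarrow> 'b) \<Rightarrow> ('b \<Rightarrow> 'b \<Rightarrow> 'k)
      \<Rightarrow> ('b \<Rightarrow> 'b) \<Rightarrow> 'b \<Rightarrow> bool" where
  "symplectic_double_extension s G brG \<omega>G t H brH \<omega>H D z \<longleftrightarrow>
     symplectic_lie_algebra s G brG \<omega>G \<and> symplectic_lie_algebra t H brH \<omega>H \<and>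
     lie_derivation t H brH D \<and> z \<in> H \<and>
     (\<exists>e d \<iota>.
        e \<in> G \<and> d \<in> G \<and> \<iota> ` H \<subseteq> G \<and> linear_map_on t s H \<iota> \<and>
        bij_betw (\<lambda>(\<alpha>, a, \<beta>). s \<alpha> e + \<iota> a + s \<beta> d) (UNIV \<times> H \<times> UNIV) G \<and>
        (\<forall>a\<in>H. \<forall>b\<in>H. brG (\<iota> a) (\<iota> b) =
           \<iota> (brH a b) + s (\<omega>H (D a + form_adjoint H \<omega>H D a) b) e) \<and>
        (\<forall>a\<in>H. brG (\<iota> a) d = \<iota> (D a) + s (\<omega>H z a) e) \<and>
        brG d d = 0 \<and>
        (\<forall>x\<in>G. brG e x = 0) \<and>
        (\<forall>a\<in>H. \<forall>b\<in>H. \<omega>G (\<iota> a) (\<iota> b) = \<omega>H a b) \<and>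
        \<omega>G e d = 1 \<and>
        (\<forall>a\<in>H. \<omega>G e (\<iota> a) = 0 \<and> \<omega>G d (\<iota> a) = 0))"

end

theory Submission
  imports Defs
begin

text \<open>
  Closedness of \<open>\<omega>\<close> makes \<open>[\<gg>, \<gg>]\<close> orthogonal to the center, so every nonzero central \<open>e\<close>
  exhibits \<open>\<gg>\<close> as a double extension: choose \<open>d\<close> with \<open>\<omega>(e, d) = 1\<close>, let \<open>\<hh>\<close> be the orthogonal
  complement of \<open>{e, d}\<close> with the projected bracket, \<open>D\<close> the projection of \<open>[\<cdot>, d]\<close>, and read \<open>z\<close> off
  the \<open>e\<close>-component of \<open>[\<cdot>, d]\<close>. A 2-nilpotent algebra has such an \<open>e\<close>: a nonzero bracket if there
  is one, any nonzero vector otherwise.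

  For any double extension, brackets, form and the adjoints \<open>ad\<^sub>u\<^sup>*\<close> have explicit expressions in
  the coordinates \<open>\<alpha> e + a + \<beta> d\<close>. Comparing components, \<open>\<gg>\<close> is symplectic Poisson exactly if \<open>\<hh>\<close>
  is and \<open>(D, z)\<close> is admissible, whichever \<open>e\<close> was chosen.
\<close>

section \<open>Linear maps and Lie brackets on a carrier subspace\<close>

lemma linear_map_onD:
  assumes "linear_map_on s t V f"
  shows "x \<in> V \<Longrightarrow> y \<in> V \<Longrightarrow> f (x + y) = f x + f y"
    and "x \<in> V \<Longrightarrow> f (s c x) = t c (f x)"
  using assms by (simp_all add: linear_map_on_def)

lemma linear_map_on_zero_uminus_diff:
  assumes "vector_space s" "vector_space t" "module.subspace s V" "linear_map_on s t V f"
  shows "f 0 = 0"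
    and "x \<in> V \<Longrightarrow> f (- x) = - f x"
    and "x \<in> V \<Longrightarrow> y \<in> V \<Longrightarrow> f (x - y) = f x - f y"
proof -
  interpret s: vector_space s by fact
  interpret t: vector_space t by fact
  have 0: "0 \<in> V" using assms(3) by (rule s.subspace_0)
  show "f 0 = 0" using linear_map_onD(2)[OF assms(4) 0, of 0] by simp
  show minus: "f (- x) = - f x" if "x \<in> V" for x
    using linear_map_onD(2)[OF assms(4) that, of "-1"] by simp
  show "f (x - y) = f x - f y" if "x \<in> V" "y \<in> V"
    using linear_map_onD(1)[OF assms(4) that(1) s.subspace_neg[OF assms(3) that(2)]]
      minus[OF that(2)] by simp
qed

context lie_algebra
begin

lemma carrier_closed [simp]:
  "0 \<in> V"
  "x \<in> V \<Longrightarrow> y \<in> V \<Longrightarrow> x + y \<in> V"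
  "x \<in> V \<Longrightarrow> y \<in> V \<Longrightarrow> x - y \<in> V"
  "x \<in> V \<Longrightarrow> - x \<in> V"
  "x \<in> V \<Longrightarrow> scale c x \<in> V"
  "x \<in> V \<Longrightarrow> y \<in> V \<Longrightarrow> br x y \<in> V"
  using carrier_subspace
  by (simp_all add: subspace_0 subspace_add subspace_diff subspace_neg subspace_scale br_closed)

lemma br_right [simp]:
  assumes "u \<in> V"
  shows "x \<in> V \<Longrightarrow> y \<in> V \<Longrightarrow> br u (x + y) = br u x + br u y"
    and "x \<in> V \<Longrightarrow> br u (scale c x) = scale c (br u x)"
    and "br u 0 = 0"
    and "x \<in> V \<Longrightarrow> br u (- x) = - br u x"
    and "x \<in> V \<Longrightarrow> y \<in> V \<Longrightarrow> br u (x - y) = br u x - br u y"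
  by (fact linear_map_onD[OF br_linear_right[OF assms]]
    linear_map_on_zero_uminus_diff[OF vector_space_axioms vector_space_axioms carrier_subspace
      br_linear_right[OF assms]])+

lemma br_left [simp]:
  assumes "u \<in> V"
  shows "x \<in> V \<Longrightarrow> y \<in> V \<Longrightarrow> br (x + y) u = br x u + br y u"
    and "x \<in> V \<Longrightarrow> br (scale c x) u = scale c (br x u)"
    and "br 0 u = 0"
    and "x \<in> V \<Longrightarrow> br (- x) u = - br x u"
    and "x \<in> V \<Longrightarrow> y \<in> V \<Longrightarrow> br (x - y) u = br x u - br y u"
  by (fact linear_map_onD[OF br_linear_left[OF assms]]
    linear_map_on_zero_uminus_diff[OF vector_space_axioms vector_space_axioms carrier_subspace
      br_linear_left[OF assms]])+

lemma br_skew: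
  assumes "u \<in> V" "v \<in> V"
  shows "br u v = - br v u"
proof -
  have "br (u + v) (u + v) = 0" using assms by (intro br_alternating) simp
  then have "br u v + br v u = 0"
    using assms br_alternating[OF assms(1)] br_alternating[OF assms(2)] by (simp add: add.commute)
  then show ?thesis by (simp add: eq_neg_iff_add_eq_0)
qed

lemma in_lie_center:
  assumes "u \<in> lie_center V br" "v \<in> V"
  shows "u \<in> V" "br u v = 0" "br v u = 0"
proof -
  show u: "u \<in> V" and uv: "br u v = 0" using assms by (auto simp: lie_center_def)
  show "br v u = 0" using br_skew[OF assms(2) u] uv by simp
qed

end

text \<open>Viewing the field as a vector space over itself lets the facts on linear maps apply to
  the functionals obtained by fixing one argument of \<omega>.\<close>

lemma vector_space_times: "vector_space ((*) :: 'k::field \<Rightarrow> 'k \<Rightarrow> 'k)"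
  by unfold_locales (simp_all add: algebra_simps)

section \<open>Nondegenerate forms, representation of functionals, and adjoints\<close>

context symplectic_lie_algebra
begin

lemma form_right [simp]:
  assumes "u \<in> V"
  shows "x \<in> V \<Longrightarrow> y \<in> V \<Longrightarrow> \<omega> u (x + y) = \<omega> u x + \<omega> u y"
    and "x \<in> V \<Longrightarrow> \<omega> u (scale c x) = c * \<omega> u x"
    and "\<omega> u 0 = 0"
    and "x \<in> V \<Longrightarrow> \<omega> u (- x) = - \<omega> u x"
    and "x \<in> V \<Longrightarrow> y \<in> V \<Longrightarrow> \<omega> u (x - y) = \<omega> u x - \<omega> u y"
  by (fact linear_map_onD[OF form_linear_right[OF assms]]
    linear_map_on_zero_uminus_diff[OF vector_space_axioms vector_space_times carrier_subspace
      form_linear_right[OF assms]])+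

lemma form_left [simp]:
  assumes "u \<in> V"
  shows "x \<in> V \<Longrightarrow> y \<in> V \<Longrightarrow> \<omega> (x + y) u = \<omega> x u + \<omega> y u"
    and "x \<in> V \<Longrightarrow> \<omega> (scale c x) u = c * \<omega> x u"
    and "\<omega> 0 u = 0"
    and "x \<in> V \<Longrightarrow> \<omega> (- x) u = - \<omega> x u"
    and "x \<in> V \<Longrightarrow> y \<in> V \<Longrightarrow> \<omega> (x - y) u = \<omega> x u - \<omega> y u"
  by (fact linear_map_onD[OF form_linear_left[OF assms]]
    linear_map_on_zero_uminus_diff[OF vector_space_axioms vector_space_times carrier_subspace
      form_linear_left[OF assms]])+

lemma form_eqI_left:
  assumes "x \<in> V" "y \<in> V" "\<And>u. u \<in> V \<Longrightarrow> \<omega> x u = \<omega> y u"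
  shows "x = y"
  using form_nondegenerate[of "x - y"] assms by simp

lemma form_eqI_right:
  assumes "x \<in> V" "y \<in> V" "\<And>u. u \<in> V \<Longrightarrow> \<omega> u x = \<omega> u y"
  shows "x = y"
proof (rule form_eqI_left)
  show "\<omega> x u = \<omega> y u" if "u \<in> V" for u
    using assms(3)[OF that] form_skew[OF assms(1) that] form_skew[OF assms(2) that] by simp
qed (fact assms)+

lemma form_sum_left:
  assumes "u \<in> V" "finite B" "B \<subseteq> V"
  shows "(\<Sum>b\<in>B. scale (c b) b) \<in> V \<and> \<omega> (\<Sum>b\<in>B. scale (c b) b) u = (\<Sum>b\<in>B. c b * \<omega> b u)"
  using assms(2,3) by induction (use assms(1) in auto)

lemma form_sum_right:
  assumes "u \<in> V" "finite B" "w ` B \<subseteq> V"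
  shows "(\<Sum>b\<in>B. scale (c b) (w b)) \<in> V \<and>
    \<omega> u (\<Sum>b\<in>B. scale (c b) (w b)) = (\<Sum>b\<in>B. c b * \<omega> u (w b))"
  using assms(2,3) by induction (use assms(1) in auto)

text \<open>Induction on \<open>B\<close>: a solution for the smaller set is corrected by a multiple
  of a vector that is orthogonal to the smaller set but not to the new element. Nondegeneracy
  provides such a vector.\<close>

lemma form_interpolation:
  assumes "finite B" "B \<subseteq> V" "independent B"
  shows "\<exists>w\<in>V. \<forall>b\<in>B. \<omega> b w = f b"
  using assms
proof (induction B arbitrary: f)
  case empty
  show ?case using carrier_closed(1) by blast
next
  case (insert b B)
  have B: "B \<subseteq> V" "b \<in> V" and indep: "independent B" and b: "b \<notin> span B"
    using insert.prems insert.hyps by (auto simp: independent_insert)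
  note IH = insert.IH[OF B(1) indep]
  obtain w0 where w0: "w0 \<in> V" "\<And>c. c \<in> B \<Longrightarrow> \<omega> c w0 = f c"
    using IH[of f] by blast
  \<comment> \<open>The induction hypothesis, applied to the indicator functions of the elements of
    \<open>B\<close>, yields vectors \<open>w c\<close> dual to \<open>B\<close>.\<close>
  have "\<exists>w. \<forall>c\<in>B. w c \<in> V \<and> (\<forall>c'\<in>B. \<omega> c' (w c) = (if c' = c then 1 else 0))"
  proof (rule bchoice, rule ballI)
    fix c
    show "\<exists>y. y \<in> V \<and> (\<forall>c'\<in>B. \<omega> c' y = (if c' = c then 1 else 0))"
      using IH[of "\<lambda>c'. if c' = c then 1 else 0"] unfolding Bex_def .
  qed
  then obtain w where
    w: "\<forall>c\<in>B. w c \<in> V \<and> (\<forall>c'\<in>B. \<omega> c' (w c) = (if c' = c then 1 else 0))" ..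
  then have wV: "w ` B \<subseteq> V" by blast
  \<comment> \<open>Otherwise \<open>b\<close> and its expansion along the dual vectors \<open>w\<close> pair equally with all of \<open>V\<close>.\<close>
  have "\<exists>y\<in>V. (\<forall>c\<in>B. \<omega> c y = 0) \<and> \<omega> b y \<noteq> 0"
  proof (rule ccontr)
    assume neg: "\<not> ?thesis"
    let ?b = "\<Sum>c\<in>B. scale (\<omega> b (w c)) c"
    have "b = ?b"
    proof (rule form_eqI_left)
      show "b \<in> V" "?b \<in> V"
        using B form_sum_left[OF carrier_closed(1) insert.hyps(1) B(1)] by auto
    next
      fix u assume u: "u \<in> V"
      let ?y = "\<Sum>c\<in>B. scale (\<omega> c u) (w c)"
      have yV: "?y \<in> V"
        using form_sum_right[OF u insert.hyps(1) wV] by simp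
      have wy: "\<omega> x ?y = (\<Sum>c\<in>B. \<omega> c u * \<omega> x (w c))" if "x \<in> V" for x
        using form_sum_right[OF that insert.hyps(1) wV] by simp
      \<comment> \<open>\<open>?y\<close> pairs with \<open>B\<close> exactly as \<open>u\<close>
        does, so \<open>neg\<close> forces the difference to be orthogonal to \<open>b\<close> as
        well.\<close>
      have "\<omega> c (u - ?y) = 0" if "c \<in> B" for c
      proof -
        have "(\<Sum>c'\<in>B. \<omega> c' u * \<omega> c (w c')) = (\<Sum>c'\<in>B. if c' = c then \<omega> c u else 0)"
          using that w by (intro sum.cong) auto
        then show ?thesis
          using that B u yV wy[of c] insert.hyps(1) by (simp add: subset_eq)
      qed
      then have "\<omega> b (u - ?y) = 0" using neg u yV by (meson carrier_closed(3))
      then have "\<omega> b u = (\<Sum>c\<in>B. \<omega> b (w c) * \<omega> c u)"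
        using u yV B wy[of b] by (simp add: mult.commute)
      also have "\<dots> = \<omega> ?b u"
        using form_sum_left[OF u insert.hyps(1) B(1)] by simp
      finally show "\<omega> b u = \<omega> ?b u" .
    qed
    moreover have "?b \<in> span B" by (intro span_sum span_scale span_base)
    ultimately show False using b by simp
  qed
  then obtain y where y: "y \<in> V" "\<And>c. c \<in> B \<Longrightarrow> \<omega> c y = 0" "\<omega> b y \<noteq> 0" by blast
  \<comment> \<open>Adding a multiple of \<open>y\<close> keeps the values on \<open>B\<close> and
    moves the value at \<open>b\<close> from \<open>\<omega> b w0\<close> to
    \<open>f b\<close>.\<close>
  let ?x = "w0 + scale ((f b - \<omega> b w0) / \<omega> b y) y"
  have "\<forall>c\<in>insert b B. \<omega> c ?x = f c" using B w0 y by (auto simp: subset_eq)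
  moreover have "?x \<in> V" using w0 y by simp
  ultimately show ?case by blast
qed

text \<open>Interpolate \<open>f\<close> on a finite basis of \<open>V\<close>, then extend the
  equality by linearity. This is what makes adjoints exist in finite dimension.\<close>

lemma form_represents_functional:
  assumes "finite_dimensional scale V" "linear_map_on scale (*) V f"
  obtains w where "w \<in> V" "\<And>u. u \<in> V \<Longrightarrow> f u = \<omega> u w"
proof -
  obtain A where A: "finite A" "span A = V"
    using assms(1) by (auto simp: finite_dimensional_def)
  obtain B where B: "B \<subseteq> A" "independent B" "A \<subseteq> span B"
    using maximal_independent_subset by blast
  have spanB: "span B = V" using A(2) B(1,3) span_mono[OF B(1)] span_mono[OF B(3)]
    by (simp add: span_span)
  obtain w where w: "w \<in> V" "\<And>b. b \<in> B \<Longrightarrow> \<omega> b w = f b"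
    using form_interpolation[OF finite_subset[OF B(1) A(1)] _ B(2), of f] span_superset[of B]
    unfolding spanB by blast
  note f = linear_map_onD[OF assms(2)] linear_map_on_zero_uminus_diff(1)[OF vector_space_axioms
      vector_space_times carrier_subspace assms(2)]
  have "u \<in> V \<and> f u = \<omega> u w" if "u \<in> span B" for u
    using that
  proof (induction rule: span_induct_alt)
    case base
    then show ?case using f w by simp
  next
    case (step c x y)
    then have "x \<in> V" using spanB span_base by blast
    then show ?case using f w step by simp
  qed
  then show thesis using that w spanB by blast
qed

text \<open>Nondegeneracy gives the uniqueness that the definite description in
  \<open>form_adjoint\<close> requires, so an explicit candidate only has to be checked against the
  defining equation.\<close>

lemma form_adjoint_eqI:
  assumes "w \<in> V" "\<And>u. u \<in> V \<Longrightarrow> \<omega> (F u) v = \<omega> u w"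
  shows "form_adjoint V \<omega> F v = w"
  unfolding form_adjoint_def
  by (rule the_equality) (use assms form_eqI_right in auto)

text \<open>Existence comes from representing the functional sending \<open>u\<close> to
  \<open>\<omega> (F u) v\<close>. The version with the adjoint on the left follows by applying
  skew-symmetry on both sides.\<close>

lemma form_adjoint:
  assumes "finite_dimensional scale V" "linear_map_on scale scale V F" "F ` V \<subseteq> V" "v \<in> V"
  shows form_adjoint_closed: "form_adjoint V \<omega> F v \<in> V"
    and form_adjoint_right: "u \<in> V \<Longrightarrow> \<omega> u (form_adjoint V \<omega> F v) = \<omega> (F u) v"
    and form_adjoint_left: "u \<in> V \<Longrightarrow> \<omega> (form_adjoint V \<omega> F v) u = \<omega> v (F u)"
proof -
  have FV: "F u \<in> V" if "u \<in> V" for u using that assms(3) by blast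
  have "linear_map_on scale (*) V (\<lambda>u. \<omega> (F u) v)"
    using linear_map_onD[OF assms(2)] assms(4) FV by (simp add: linear_map_on_def)
  then obtain w where w: "w \<in> V" "\<And>u. u \<in> V \<Longrightarrow> \<omega> (F u) v = \<omega> u w"
    using form_represents_functional[OF assms(1)] by blast
  have eq: "form_adjoint V \<omega> F v = w" by (rule form_adjoint_eqI[OF w])
  show "form_adjoint V \<omega> F v \<in> V" using eq w by simp
  show r: "\<omega> u (form_adjoint V \<omega> F v) = \<omega> (F u) v" if "u \<in> V" for u using eq w that by simp
  show "\<omega> (form_adjoint V \<omega> F v) u = \<omega> v (F u)" if "u \<in> V" for u
    using r[OF that] eq w(1) form_skew[OF w(1) that] form_skew[OF assms(4) FV[OF that]] by simp
qed

lemma form_adjoint_linear: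
  assumes "finite_dimensional scale V" "linear_map_on scale scale V F" "F ` V \<subseteq> V"
  shows "linear_map_on scale scale V (form_adjoint V \<omega> F)"
proof -
  have FV: "F u \<in> V" if "u \<in> V" for u using that assms(3) by blast
  note adj = form_adjoint[OF assms]
  show ?thesis
    unfolding linear_map_on_def
  proof (intro conjI ballI allI)
    fix x y assume "x \<in> V" "y \<in> V"
    then show "form_adjoint V \<omega> F (x + y) = form_adjoint V \<omega> F x + form_adjoint V \<omega> F y"
      by (intro form_adjoint_eqI) (simp_all add: adj FV)
  next
    fix c x assume "x \<in> V"
    then show "form_adjoint V \<omega> F (scale c x) = scale c (form_adjoint V \<omega> F x)"
      by (intro form_adjoint_eqI) (simp_all add: adj FV)
  qed
qed

text \<open>In the cyclic identity for \<open>u\<close>, \<open>v\<close>, \<open>c\<close>, the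
  other two terms contain a bracket with the central \<open>c\<close> and vanish.\<close>

lemma form_br_center:
  assumes "c \<in> lie_center V br" "u \<in> V" "v \<in> V"
  shows "\<omega> (br u v) c = 0" "\<omega> c (br u v) = 0"
proof -
  note c = in_lie_center[OF assms(1)]
  show "\<omega> (br u v) c = 0"
    using form_closed[of u v c] c[OF assms(2)] c[OF assms(3)] assms by simp
  then show "\<omega> c (br u v) = 0"
    using form_skew[of c "br u v"] c[OF assms(2)] assms by simp
qed

end

text \<open>Skew-symmetry gives \<open>2 * \<omega> x x = 0\<close>, and 2 is invertible in
  characteristic 0.\<close>

lemma symplectic_form_alternating:
  fixes s :: "'k::field_char_0 \<Rightarrow> 'a::ab_group_add \<Rightarrow> 'a"
  assumes "symplectic_lie_algebra s V br \<omega>" "x \<in> V"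
  shows "\<omega> x x = 0"
  using symplectic_lie_algebra.form_skew[OF assms(1,2,2)]
  by (simp add: eq_neg_iff_add_eq_0 flip: mult_2)

section \<open>Coordinates on a double extension with fixed \<open>e\<close>, \<open>d\<close> and
  \<open>\<iota>\<close>\<close>

locale symplectic_double_ext =
  g: symplectic_lie_algebra s G brG \<omega>G + h: symplectic_lie_algebra t H brH \<omega>H
  for s :: "'k::field_char_0 \<Rightarrow> 'a::ab_group_add \<Rightarrow> 'a" and G brG \<omega>G
    and t :: "'k \<Rightarrow> 'b::ab_group_add \<Rightarrow> 'b" and H brH \<omega>H +
  fixes D :: "'b \<Rightarrow> 'b" and z :: 'b and e d :: 'a and \<iota> :: "'b \<Rightarrow> 'a"
  assumes fin_dim: "finite_dimensional t H"
    and derivation: "lie_derivation t H brH D"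
    and z_closed [simp]: "z \<in> H"
    and e_closed [simp]: "e \<in> G"
    and d_closed [simp]: "d \<in> G"
    and \<iota>_image: "\<iota> ` H \<subseteq> G"
    and \<iota>_linear: "linear_map_on t s H \<iota>"
    and decomposition: "bij_betw (\<lambda>(\<alpha>, a, \<beta>). s \<alpha> e + \<iota> a + s \<beta> d) (UNIV \<times> H \<times> UNIV) G"
    and br_\<iota>: "a \<in> H \<Longrightarrow> b \<in> H \<Longrightarrow>
      brG (\<iota> a) (\<iota> b) = \<iota> (brH a b) + s (\<omega>H (D a + form_adjoint H \<omega>H D a) b) e"
    and br_\<iota>_d: "a \<in> H \<Longrightarrow> brG (\<iota> a) d = \<iota> (D a) + s (\<omega>H z a) e"
    and br_e: "x \<in> G \<Longrightarrow> brG e x = 0"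
    and form_\<iota>: "a \<in> H \<Longrightarrow> b \<in> H \<Longrightarrow> \<omega>G (\<iota> a) (\<iota> b) = \<omega>H a b"
    and form_e_d: "\<omega>G e d = 1"
    and form_e_\<iota>: "a \<in> H \<Longrightarrow> \<omega>G e (\<iota> a) = 0"
    and form_d_\<iota>: "a \<in> H \<Longrightarrow> \<omega>G d (\<iota> a) = 0"
begin

abbreviation "Ds \<equiv> form_adjoint H \<omega>H D"
abbreviation "ads a \<equiv> form_adjoint H \<omega>H (brH a)"

lemmas form_alternating [simp] =
  symplectic_form_alternating[OF g.symplectic_lie_algebra_axioms]
  symplectic_form_alternating[OF h.symplectic_lie_algebra_axioms]

lemma \<iota>_closed [simp]: "a \<in> H \<Longrightarrow> \<iota> a \<in> G"
  using \<iota>_image by blast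

lemmas \<iota>_simps [simp] = linear_map_onD[OF \<iota>_linear]
  linear_map_on_zero_uminus_diff[OF h.vector_space_axioms g.vector_space_axioms
    h.carrier_subspace \<iota>_linear]

lemma D_linear: "linear_map_on t t H D" and D_image: "D ` H \<subseteq> H"
  using derivation by (simp_all add: lie_derivation_def)

lemma D_closed [simp]: "a \<in> H \<Longrightarrow> D a \<in> H"
  using D_image by blast

lemmas D_simps [simp] = linear_map_onD[OF D_linear]
  linear_map_on_zero_uminus_diff[OF h.vector_space_axioms h.vector_space_axioms
    h.carrier_subspace D_linear]

lemmas Ds_form [simp] = h.form_adjoint[OF fin_dim D_linear D_image]

lemmas Ds_linear = h.form_adjoint_linear[OF fin_dim D_linear D_image]

lemmas Ds_simps [simp] = linear_map_onD[OF Ds_linear]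
  linear_map_on_zero_uminus_diff[OF h.vector_space_axioms h.vector_space_axioms
    h.carrier_subspace Ds_linear]

lemma ad_image: "a \<in> H \<Longrightarrow> brH a ` H \<subseteq> H"
  by auto

lemmas ads_form [simp] = h.form_adjoint[OF fin_dim h.br_linear_right ad_image]

lemmas ads_linear = h.form_adjoint_linear[OF fin_dim h.br_linear_right ad_image]

lemmas ads_simps [simp] = linear_map_onD[OF ads_linear]
  linear_map_on_zero_uminus_diff[OF h.vector_space_axioms h.vector_space_axioms
    h.carrier_subspace ads_linear]

lemma ads_zero [simp]: "b \<in> H \<Longrightarrow> ads 0 b = 0"
  by (rule h.form_adjoint_eqI) simp_all

definition coord :: "'k \<Rightarrow> 'b \<Rightarrow> 'k \<Rightarrow> 'a" where
  "coord \<alpha> a \<beta> = s \<alpha> e + \<iota> a + s \<beta> d"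

lemma coord_closed [simp]: "a \<in> H \<Longrightarrow> coord \<alpha> a \<beta> \<in> G"
  by (simp add: coord_def)

lemma coord_cases:
  assumes "x \<in> G"
  obtains \<alpha> a \<beta> where "a \<in> H" "x = coord \<alpha> a \<beta>"
proof -
  have "x \<in> (\<lambda>(\<alpha>, a, \<beta>). s \<alpha> e + \<iota> a + s \<beta> d) ` (UNIV \<times> H \<times> UNIV)"
    using assms decomposition by (simp add: bij_betw_def)
  then show thesis using that by (auto simp: coord_def)
qed

text \<open>Injectivity of the decomposition: each identity in \<open>G\<close> splits into its
  \<open>e\<close>-, \<open>H\<close>- and \<open>d\<close>-components. All later conditions on
  \<open>D\<close> and \<open>z\<close> are read off in this way.\<close>

lemma coord_eq_iff:
  assumes "a \<in> H" "b \<in> H"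
  shows "coord \<alpha> a \<beta> = coord \<alpha>' b \<beta>' \<longleftrightarrow> \<alpha> = \<alpha>' \<and> a = b \<and> \<beta> = \<beta>'"
  using bij_betw_imp_inj_on[OF decomposition, THEN inj_onD, of "(\<alpha>, a, \<beta>)" "(\<alpha>', b, \<beta>')"] assms
  by (auto simp: coord_def)

text \<open>Writing zero in coordinates makes \<open>coord_eq_iff\<close> applicable to equations
  with right-hand side zero.\<close>

lemma zero_coord: "0 = coord 0 0 0"
  by (simp add: coord_def)

lemma br_coord [simp]:
  assumes "a \<in> H" "b \<in> H"
  shows "brG (coord \<alpha> a \<beta>) (coord \<alpha>' b \<beta>') =
    coord (\<omega>H (D a + Ds a) b + \<beta>' * \<omega>H z a - \<beta> * \<omega>H z b) (brH a b + t \<beta>' (D a) - t \<beta> (D b)) 0"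
proof -
  have e: "brG x e = 0" if "x \<in> G" for x
    using g.br_skew[OF that e_closed] br_e[OF that] by simp
  have d: "brG d (\<iota> b) = - (\<iota> (D b) + s (\<omega>H z b) e)"
    using g.br_skew[OF d_closed \<iota>_closed[OF assms(2)]] br_\<iota>_d[OF assms(2)] by simp
  show ?thesis
    using assms
    by (simp add: coord_def br_e e d br_\<iota> br_\<iota>_d g.br_alternating g.scale_right_distrib
        g.scale_left_distrib g.scale_left_diff_distrib algebra_simps)
qed

lemma form_coord [simp]:
  assumes "a \<in> H" "b \<in> H"
  shows "\<omega>G (coord \<alpha> a \<beta>) (coord \<alpha>' b \<beta>') = \<omega>H a b + \<alpha> * \<beta>' - \<beta> * \<alpha>'"
proof -
  have "\<omega>G d e = -1" using g.form_skew[of d e] form_e_d by simp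
  moreover have "\<omega>G (\<iota> a) e = 0" "\<omega>G (\<iota> a) d = 0"
    using g.form_skew[of "\<iota> a"] form_e_\<iota> form_d_\<iota> assms by simp_all
  ultimately show ?thesis
    using assms
    by (simp add: coord_def form_\<iota> form_e_d form_e_\<iota> form_d_\<iota> algebra_simps)
qed

text \<open>Pair the bracket with \<open>u = coord \<alpha>' c \<beta>'\<close> against the given
  vector. The parts depending on \<open>\<alpha>'\<close>, \<open>c\<close> and
  \<open>\<beta>'\<close> determine the \<open>d\<close>-component, the \<open>H\<close>-component
  and minus the \<open>e\<close>-component of the adjoint. As \<open>e\<close> is central,
  \<open>\<alpha>'\<close> does not occur and the \<open>d\<close>-component is 0.\<close>

lemma adjoint_coord [simp]:
  assumes "a \<in> H" "b \<in> H"
  shows "form_adjoint G \<omega>G (brG (coord \<alpha> a \<beta>)) (coord \<gamma> b \<delta>) =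
    coord (- \<omega>H (D a) b - \<delta> * \<omega>H z a)
      (ads a b - t \<delta> (D a + Ds a) - t \<beta> (Ds b) + t (\<beta> * \<delta>) z) 0"
proof (rule g.form_adjoint_eqI)
  fix u assume "u \<in> G"
  then obtain \<alpha>' c \<beta>' where c: "c \<in> H" and u: "u = coord \<alpha>' c \<beta>'"
    by (rule coord_cases)
  show "\<omega>G (brG (coord \<alpha> a \<beta>) u) (coord \<gamma> b \<delta>) = \<omega>G u
    (coord (- \<omega>H (D a) b - \<delta> * \<omega>H z a)
      (ads a b - t \<delta> (D a + Ds a) - t \<beta> (Ds b) + t (\<beta> * \<delta>) z) 0)"
    using assms c h.form_skew[of c "D a"] h.form_skew[of c z] h.form_skew[of "D c" a]
    by (simp add: u algebra_simps)
qed (use assms in simp)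

section \<open>Transfer of the Poisson condition between \<open>G\<close> and
  \<open>H\<close>\<close>

lemma in_lie_centerI:
  assumes "c \<in> H" "\<And>a. a \<in> H \<Longrightarrow> brH a c = 0"
  shows "c \<in> lie_center H brH"
  using assms h.br_skew[OF assms(1)] by (simp add: lie_center_def)

lemma poisson_imp_admissible:
  assumes "symplectic_poisson_algebra s G brG \<omega>G"
  shows "symplectic_poisson_algebra t H brH \<omega>H" "admissible t H brH \<omega>H D z"
proof -
  interpret P: symplectic_poisson_algebra s G brG \<omega>G by fact
  \<comment> \<open>Here \<open>coord 0 0 1\<close> is \<open>d\<close>. The four triples are
    (a,b,c), (a,b,d), (a,d,b) and (a,d,d); their \<open>e\<close>- and \<open>H\<close>-components
    give these equations.\<close>
  have nil: "brH (brH a b) c = 0" "D (brH a b) = 0" "brH (D a) b = 0" "D (D a) = 0"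
    "\<omega>H (D (brH a b) + Ds (brH a b)) c = 0" "\<omega>H (D (D a) + Ds (D a)) b = 0"
    "\<omega>H z (D a) = 0"
    if "a \<in> H" "b \<in> H" "c \<in> H" for a b c
    using P.two_nilpotent[of "coord 0 a 0" "coord 0 b 0" "coord 0 c 0"]
      P.two_nilpotent[of "coord 0 a 0" "coord 0 b 0" "coord 0 0 1"]
      P.two_nilpotent[of "coord 0 a 0" "coord 0 0 1" "coord 0 b 0"]
      P.two_nilpotent[of "coord 0 a 0" "coord 0 0 1" "coord 0 0 1"] that
    by (simp_all add: zero_coord coord_eq_iff)
  have Ds_br: "Ds (brH a b) = 0" if "a \<in> H" "b \<in> H" for a b
    using nil(2,5)[OF that] that by (intro h.form_nondegenerate) simp_all
  have Ds_D: "Ds (D a) = 0" if "a \<in> H" for a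
    using nil(4,6)[OF that] that by (intro h.form_nondegenerate) simp_all
  have Ds_z: "Ds z = 0"
    using nil(7) by (intro h.form_nondegenerate) simp_all
  \<comment> \<open>The adjoint of ad \<open>d\<close> sends \<open>d\<close> to \<open>z\<close>
    and \<open>a\<close> in \<open>H\<close> to \<open>- Ds a\<close>. Commuting it with ad
    \<open>d\<close> and with ad \<open>a\<close>, and comparing \<open>H\<close>-components, gives
    this and the next three facts; the terms on the other side vanish by \<open>Ds_D\<close>,
    \<open>Ds_br\<close> or because \<open>[d,d] = 0\<close>.\<close>
  have D_z: "D z = 0"
    using P.ad_commutes_adjoint[of "coord 0 0 1" "coord 0 0 1" "coord 0 0 1"]
    by (simp add: zero_coord coord_eq_iff)
  have D_Ds: "D (Ds a) = 0" if "a \<in> H" for a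
    using P.ad_commutes_adjoint[of "coord 0 0 1" "coord 0 0 1" "coord 0 a 0"] that
    by (simp add: Ds_D coord_eq_iff)
  have br_z: "brH a z = 0" if "a \<in> H" for a
    using P.ad_commutes_adjoint[of "coord 0 a 0" "coord 0 0 1" "coord 0 0 1"] that
    by (simp add: Ds_D coord_eq_iff)
  have br_Ds: "brH a (Ds b) = 0" if "a \<in> H" "b \<in> H" for a b
    using P.ad_commutes_adjoint[of "coord 0 a 0" "coord 0 0 1" "coord 0 b 0"] that
    by (simp add: Ds_br coord_eq_iff)
  have comm: "brH a (ads b c) = ads b (brH a c)" if "a \<in> H" "b \<in> H" "c \<in> H" for a b c
    using P.ad_commutes_adjoint[of "coord 0 a 0" "coord 0 b 0" "coord 0 c 0"] that
    by (simp add: coord_eq_iff)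
  show "symplectic_poisson_algebra t H brH \<omega>H"
    by unfold_locales (use nil(1) comm in auto)
  have "D a \<in> lie_center H brH" if "a \<in> H" for a
    using nil(3) that by (simp add: lie_center_def)
  moreover have "Ds a \<in> lie_center H brH" if "a \<in> H" for a
    using br_Ds that by (simp add: in_lie_centerI)
  moreover have "z \<in> lie_center H brH"
    using br_z by (simp add: in_lie_centerI)
  ultimately show "admissible t H brH \<omega>H D z"
    using derivation nil(4) Ds_D D_Ds Ds_z D_z by (auto simp: admissible_def Let_def)
qed

lemma admissible_imp_poisson:
  assumes "symplectic_poisson_algebra t H brH \<omega>H" "admissible t H brH \<omega>H D z"
  shows "symplectic_poisson_algebra s G brG \<omega>G"
proof -
  interpret P: symplectic_poisson_algebra t H brH \<omega>H by fact
  have central: "z \<in> lie_center H brH" "a \<in> H \<Longrightarrow> D a \<in> lie_center H brH"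
    "a \<in> H \<Longrightarrow> Ds a \<in> lie_center H brH" for a
    using assms(2) by (auto simp: admissible_def Let_def)
  have sq [simp]: "D z = 0" "Ds z = 0" "a \<in> H \<Longrightarrow> D (D a) = 0" "a \<in> H \<Longrightarrow> Ds (D a) = 0"
    "a \<in> H \<Longrightarrow> D (Ds a) = 0" for a
    using assms(2) by (auto simp: admissible_def Let_def)
  note central_br [simp] =
    h.in_lie_center(2,3)[OF central(1)]
    h.in_lie_center(2,3)[OF central(2)]
    h.in_lie_center(2,3)[OF central(3)]
  note central_form [simp] =
    h.form_br_center[OF central(1)]
    h.form_br_center[OF central(2)]
    h.form_br_center[OF central(3)]
  \<comment> \<open>The derivation rule leaves only brackets with central values of
    \<open>D\<close>.\<close>
  have D_br [simp]: "D (brH a b) = 0" if "a \<in> H" "b \<in> H" for a b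
    using derivation that by (simp add: lie_derivation_def)
  \<comment> \<open>Pairing with \<open>u\<close> gives \<open>\<omega>H (brH a b) (D u)\<close>,
    which is zero because brackets are orthogonal to the center. The same orthogonality makes
    \<open>ads a\<close> kill central elements.\<close>
  have Ds_br [simp]: "Ds (brH a b) = 0" if "a \<in> H" "b \<in> H" for a b
    using that by (intro h.form_nondegenerate) simp_all
  have ads_central [simp]: "ads a z = 0" "b \<in> H \<Longrightarrow> ads a (D b) = 0"
    "b \<in> H \<Longrightarrow> ads a (Ds b) = 0"
    if "a \<in> H" for a b
    using that by (auto intro: h.form_nondegenerate)
  \<comment> \<open>Both maps are moved to the other argument of the form, where
    \<open>brH a (Ds u)\<close> vanishes since \<open>Ds u\<close> is central.\<close>
  have D_ads [simp]: "D (ads a b) = 0" if "a \<in> H" "b \<in> H" for a b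
  proof (rule h.form_eqI_right)
    fix u assume u: "u \<in> H"
    have "\<omega>H u (D (ads a b)) = \<omega>H (Ds u) (ads a b)"
      by (rule Ds_form(3)[symmetric]) (use that u in simp_all)
    also have "\<dots> = \<omega>H (brH a (Ds u)) b" by (rule ads_form(2)) (use that u in simp_all)
    also have "\<dots> = \<omega>H u 0" using that u by simp
    finally show "\<omega>H u (D (ads a b)) = \<omega>H u 0" .
  qed (use that in simp_all)
  \<comment> \<open>Moving \<open>D\<close> across the form produces \<open>Ds (D b)\<close> or
    \<open>Ds z\<close>.\<close>
  have form_zero [simp]: "\<omega>H (D a) (D b) = 0" "\<omega>H (D a) z = 0" "\<omega>H z (D a) = 0"
    if "a \<in> H" "b \<in> H" for a b
    using h.form_adjoint_right[OF fin_dim D_linear D_image _ that(1), of "D b"]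
      h.form_adjoint_right[OF fin_dim D_linear D_image _ that(1), of z]
      h.form_adjoint_left[OF fin_dim D_linear D_image _ that(1), of z] that
    by simp_all
  show ?thesis
  proof unfold_locales
    fix u v w assume "u \<in> G" "v \<in> G" "w \<in> G"
    then obtain \<alpha> a \<beta> \<alpha>' b \<beta>' \<gamma> c \<delta>
      where abc: "a \<in> H" "b \<in> H" "c \<in> H"
        and eq: "u = coord \<alpha> a \<beta>" "v = coord \<alpha>' b \<beta>'" "w = coord \<gamma> c \<delta>"
      by (metis coord_cases)
    show "brG (brG u v) w = 0"
      using abc by (simp add: eq zero_coord coord_eq_iff P.two_nilpotent)
    \<comment> \<open>Every term with \<open>D\<close>, \<open>Ds\<close> or \<open>z\<close>
      cancels and only \<open>H\<close>-components remain: \<open>brH a (ads b c)\<close> on the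
      left and \<open>ads b (brH a c)\<close> on the right.\<close>
    show "brG u (form_adjoint G \<omega>G (brG v) w) = form_adjoint G \<omega>G (brG v) (brG u w)"
      using abc by (simp add: eq coord_eq_iff P.ad_commutes_adjoint)
  qed
qed

lemma double_extension:
  "symplectic_double_extension s G brG \<omega>G t H brH \<omega>H D z"
  unfolding symplectic_double_extension_def
  by (intro conjI; (rule exI[of _ e], rule exI[of _ d], rule exI[of _ \<iota>])?)
    (use g.symplectic_lie_algebra_axioms h.symplectic_lie_algebra_axioms derivation \<iota>_image
      \<iota>_linear decomposition br_\<iota> br_\<iota>_d br_e form_\<iota> form_e_d form_e_\<iota> form_d_\<iota>
      in \<open>simp_all add: g.br_alternating\<close>)

end

lemma symplectic_double_extensionE:
  fixes s :: "'k::field_char_0 \<Rightarrow> 'a::ab_group_add \<Rightarrow> 'a"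
  assumes "symplectic_double_extension s G brG \<omega>G t H brH \<omega>H D z" "finite_dimensional t H"
  obtains e d \<iota> where "symplectic_double_ext s G brG \<omega>G t H brH \<omega>H D z e d \<iota>"
proof -
  have "\<exists>e d \<iota>. symplectic_double_ext s G brG \<omega>G t H brH \<omega>H D z e d \<iota>"
    using assms
    unfolding symplectic_double_extension_def symplectic_double_ext_def
      symplectic_double_ext_axioms_def
    by (elim conjE ex_forward) (intro conjI allI impI; simp)
  then show thesis using that by blast
qed

section \<open>Symplectic reduction along a central line\<close>

lemma double_extension_by_central_element:
  fixes scale :: "'k::field_char_0 \<Rightarrow> 'a::ab_group_add \<Rightarrow> 'a"
  assumes "symplectic_lie_algebra scale G br \<omega>" "finite_dimensional scale G"
    and e: "e \<in> lie_center G br" "e \<noteq> 0"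
  obtains H brH D z d where
    "symplectic_double_ext scale G br \<omega> scale H brH \<omega> D z e d (\<lambda>x. x)"
    "vector_space.dim scale H + 2 = vector_space.dim scale G"
proof -
  interpret symplectic_lie_algebra scale G br \<omega> by fact
  note alt [simp] = symplectic_form_alternating[OF assms(1)]
  note [simp] = in_lie_center(2,3)[OF e(1)]
  have eG [simp]: "e \<in> G" by (rule in_lie_center(1)[OF e(1) carrier_closed(1)])
  have e_br [simp]: "\<omega> e (br x y) = 0" "\<omega> (br x y) e = 0" if "x \<in> G" "y \<in> G" for x y
    using form_br_center[OF e(1) that] by simp_all
  obtain d0 where d0: "d0 \<in> G" "\<omega> e d0 \<noteq> 0"
    using form_nondegenerate[OF eG] e(2) by blast
  define d where "d = scale (1 / \<omega> e d0) d0"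
  have dG [simp]: "d \<in> G" and e_d [simp]: "\<omega> e d = 1"
    using d0 by (simp_all add: d_def)
  have d_e [simp]: "\<omega> d e = -1"
    using form_skew[of d e] by simp
  \<comment> \<open>\<open>H\<close> is a model of the quotient of the orthogonal complement of
    \<open>e\<close> by the line through \<open>e\<close>. That complement contains \<open>e\<close>
    and all brackets.\<close>
  define H where "H = {x \<in> G. \<omega> e x = 0 \<and> \<omega> d x = 0}"
  \<comment> \<open>Brackets are orthogonal to \<open>e\<close> and so have no
    \<open>d\<close>-component. As \<open>\<omega> e d = 1\<close>, subtracting this multiple of
    \<open>e\<close> makes them orthogonal to \<open>d\<close> too. A general vector needs both
    corrections, as in \<open>proj\<close>.\<close>
  define brH where "brH a b = br a b - scale (\<omega> (br a b) d) e" for a b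
  define D where "D a = br a d - scale (\<omega> (br a d) d) e" for a
  define proj where "proj x = x - scale (\<omega> x d) e - scale (\<omega> e x) d" for x
  have HI: "x \<in> H" if "x \<in> G" "\<omega> e x = 0" "\<omega> d x = 0" for x
    using that by (simp add: H_def)
  have HG [simp]: "x \<in> G" and H_perp [simp]: "\<omega> e x = 0" "\<omega> d x = 0" if "x \<in> H" for x
    using that unfolding H_def by simp_all
  have H_perp' [simp]: "\<omega> x e = 0" "\<omega> x d = 0" if "x \<in> H" for x
    using that form_skew[of x e] form_skew[of x d] by simp_all
  have d_skew: "\<omega> d x = - \<omega> x d" if "x \<in> G" for x using form_skew[of d x] that by simp
  have H_subspace: "subspace H"
    by (intro subspaceI HI) simp_all
  have brH_closed: "brH a b \<in> H" if "a \<in> H" "b \<in> H" for a b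
    using that by (intro HI) (simp_all add: brH_def d_skew)
  have D_closed: "D a \<in> H" if "a \<in> H" for a
    using that by (intro HI) (simp_all add: D_def d_skew)
  have proj: "proj x \<in> H" if "x \<in> G" for x
    using that by (intro HI) (simp_all add: proj_def d_skew)

  have symplectic_H: "symplectic_lie_algebra scale H brH \<omega>"
  proof unfold_locales
    show "linear_map_on scale scale H (brH u)" if "u \<in> H" for u
      using that by (simp add: linear_map_on_def brH_def algebra_simps)
    show "linear_map_on scale scale H (\<lambda>u. brH u v)" if "v \<in> H" for v
      using that by (simp add: linear_map_on_def brH_def algebra_simps)
    show "brH u u = 0" if "u \<in> H" for u
      using that by (simp add: brH_def br_alternating)
    show "brH (brH u v) w + brH (brH v w) u + brH (brH w u) v = 0"
      if "u \<in> H" "v \<in> H" "w \<in> H" for u v w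
    proof -
      let ?J = "br (br u v) w + br (br v w) u + br (br w u) v"
      have J: "?J = 0" using that by (intro jacobi) simp_all
      \<comment> \<open>Multiples of the central \<open>e\<close> drop out of the inner brackets, so
        the Jacobi sum of \<open>brH\<close> is the projection of the one of
        \<open>br\<close>.\<close>
      have "brH (brH u v) w + brH (brH v w) u + brH (brH w u) v = ?J - scale (\<omega> ?J d) e"
        using that by (simp add: brH_def algebra_simps)
      then show ?thesis unfolding J by simp
    qed
    show "linear_map_on scale (*) H (\<omega> u)" "linear_map_on scale (*) H (\<lambda>v. \<omega> v u)"
      if "u \<in> H" for u
      using that by (simp_all add: linear_map_on_def)
    show "\<omega> u v = - \<omega> v u" if "u \<in> H" "v \<in> H" for u v
      using that by (intro form_skew) simp_all
    show "u = 0" if u: "u \<in> H" and 0: "\<And>v. v \<in> H \<Longrightarrow> \<omega> u v = 0" for u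
    proof (rule form_nondegenerate)
      fix x assume x: "x \<in> G"
      \<comment> \<open>\<open>x\<close> and \<open>proj x\<close> differ by multiples of
        \<open>e\<close> and \<open>d\<close>, both orthogonal to \<open>u\<close>.\<close>
      show "\<omega> u x = 0" using 0[OF proj[OF x]] u x by (simp add: proj_def)
    qed (use u in simp)
    show "\<omega> (brH u v) w + \<omega> (brH v w) u + \<omega> (brH w u) v = 0"
      if "u \<in> H" "v \<in> H" "w \<in> H" for u v w
      using that form_closed[of u v w] by (simp add: brH_def)
  qed (use H_subspace brH_closed in auto)
  interpret h: symplectic_lie_algebra scale H brH \<omega> by fact

  \<comment> \<open>Dimension count: a basis of \<open>H\<close> together with \<open>d\<close> and
    \<open>e\<close> is a basis of \<open>G\<close>.\<close>
  obtain A where A: "finite A" "span A = G"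
    using assms(2) by (auto simp: finite_dimensional_def)
  obtain B where B: "B \<subseteq> H" "independent B" "H \<subseteq> span B"
    using maximal_independent_subset by blast
  have spanB: "span B = H"
    using B span_minimal[OF B(1) H_subspace] by blast
  have finB: "finite B"
    using independent_span_bound[OF A(1) B(2)] B(1) A(2) HG by blast
  have fin_H: "finite_dimensional scale H"
    using spanB finB by (auto simp: finite_dimensional_def)
  have d_notin: "d \<notin> span B"
    unfolding spanB using e_d H_perp(1)[of d] by auto
  \<comment> \<open>Pairing with \<open>d\<close> vanishes on \<open>d\<close> and on
    \<open>H\<close> but is -1 at \<open>e\<close>, which separates \<open>e\<close> from their
    span.\<close>
  have "subspace {x \<in> G. \<omega> d x = 0}"
    by (simp add: subspace_def)
  then have "span (insert d B) \<subseteq> {x \<in> G. \<omega> d x = 0}"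
    using B(1) by (intro span_minimal) auto
  then have e_notin: "e \<notin> span (insert d B)" by auto
  have "span (insert e (insert d B)) = G"
  proof (intro subset_antisym subsetI)
    fix x assume x: "x \<in> G"
    have "x = proj x + scale (\<omega> x d) e + scale (\<omega> e x) d" by (simp add: proj_def)
    moreover have "proj x \<in> span (insert e (insert d B))"
      using proj[OF x] spanB span_mono[of B "insert e (insert d B)"] by blast
    ultimately show "x \<in> span (insert e (insert d B))"
      by (metis span_add span_scale span_base insertCI)
  next
    show "x \<in> G" if "x \<in> span (insert e (insert d B))" for x
      using span_minimal[OF _ carrier_subspace, of "insert e (insert d B)"] that B(1) HG
      by (meson dG eG insert_subset subset_iff)
  qed
  moreover have "independent (insert e (insert d B))"
    using B(2) d_notin e_notin by (simp add: independent_insertI)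
  ultimately have "dim G = card (insert e (insert d B))"
    by (intro dim_eq_card) (simp_all add: span_span flip: A(2))
  also have "\<dots> = card B + 2"
    using finB d_notin e_notin span_base by (metis card_insert_disjoint finite_insert add_2_eq_Suc')
  finally have dim_G: "dim H + 2 = dim G"
    using dim_span_eq_card_independent[OF B(2)] spanB by simp

  \<comment> \<open>This functional is the \<open>e\<close>-component of \<open>br a d\<close>. A
    double extension writes it as \<open>\<omega> z a\<close>, whereas \<open>w\<close> represents
    it in the right argument; hence \<open>z = - w\<close>.\<close>
  have "linear_map_on scale (*) H (\<lambda>a. \<omega> (br a d) d)"
    by (simp add: linear_map_on_def)
  then obtain w where w: "w \<in> H" "\<And>a. a \<in> H \<Longrightarrow> \<omega> (br a d) d = \<omega> a w"
    using h.form_represents_functional[OF fin_H] by blast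
  have form_w: "\<omega> (- w) a = \<omega> (br a d) d" if "a \<in> H" for a
    using w that form_skew[of w a] by simp
  have D_linear: "linear_map_on scale scale H D"
    by (simp add: linear_map_on_def D_def algebra_simps)
  have D_image: "D ` H \<subseteq> H" using D_closed by blast
  note adj = h.form_adjoint[OF fin_H D_linear D_image]
  have derivation: "lie_derivation scale H brH D"
    unfolding lie_derivation_def
  proof (intro conjI ballI)
    fix a b assume ab: "a \<in> H" "b \<in> H"
    \<comment> \<open>By Jacobi, bracketing with \<open>d\<close> on the right is a derivation of
      \<open>br\<close>; projecting along the central \<open>e\<close> preserves the rule.\<close>
    have "br (br a b) d + br (br b d) a + br (br d a) b = 0"
      using ab by (intro jacobi) simp_all
    then have J: "br (br a b) d = br (br a d) b + br a (br b d)"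
      using ab br_skew[of "br b d" a] br_skew[of d a] by (simp add: algebra_simps)
    have "D (brH a b) = br (br a b) d - scale (\<omega> (br (br a b) d) d) e"
      using ab by (simp add: D_def brH_def)
    also have "\<dots> = brH (D a) b + brH a (D b)"
      unfolding J using ab by (simp add: D_def brH_def algebra_simps)
    finally show "D (brH a b) = brH (D a) b + brH a (D b)" .
  qed (use D_image D_linear in simp_all)
  have "symplectic_double_ext scale G br \<omega> scale H brH \<omega> D (- w) e d (\<lambda>x. x)"
  proof unfold_locales
    show "bij_betw (\<lambda>(\<alpha>, a, \<beta>). scale \<alpha> e + a + scale \<beta> d) (UNIV \<times> H \<times> UNIV) G"
      \<comment> \<open>The inverse reads off the coordinates: pairing with \<open>d\<close> gives
        the \<open>e\<close>-coefficient, pairing with \<open>e\<close> the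
        \<open>d\<close>-coefficient.\<close>
      by (rule bij_betw_byWitness[where f' = "\<lambda>x. (\<omega> x d, proj x, \<omega> e x)"])
        (use proj in \<open>auto simp: proj_def\<close>)
    show "br a b = brH a b + scale (\<omega> (D a + form_adjoint H \<omega> D a) b) e"
      if ab: "a \<in> H" "b \<in> H" for a b
    proof -
      \<comment> \<open>The \<open>e\<close>-component of \<open>br a b\<close> is
        \<open>\<omega> (br a b) d\<close>; closedness at \<open>a\<close>, \<open>b\<close>,
        \<open>d\<close> expresses it through \<open>D\<close>, the \<open>e\<close>-parts being
        invisible to the form on \<open>H\<close>.\<close>
      have "\<omega> (D a + form_adjoint H \<omega> D a) b = \<omega> (D a) b + \<omega> a (D b)"
        using adj[OF ab(1)] ab D_closed by simp
      also have "\<dots> = \<omega> (br a d) b + \<omega> a (br b d)"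
        using ab by (simp add: D_def)
      also have "\<dots> = \<omega> (br a b) d"
        using ab form_closed[of a b d] form_skew[of a "br b d"] br_skew[of d a]
        by (simp add: algebra_simps)
      finally show ?thesis by (simp add: brH_def)
    qed
    show "br a d = D a + scale (\<omega> (- w) a) e" if "a \<in> H" for a
      unfolding form_w[OF that] by (simp add: D_def)
  qed (use fin_H derivation w in \<open>auto simp: linear_map_on_def\<close>)
  then show thesis using dim_G by (rule that)
qed

theorem theorem5p1:
  fixes scale :: "'k::field_char_0 \<Rightarrow> 'a::ab_group_add \<Rightarrow> 'a"
    and G :: "'a set" and br :: "'a \<Rightarrow> 'a \<Rightarrow> 'a" and \<omega> :: "'a \<Rightarrow> 'a \<Rightarrow> 'k"
  assumes "symplectic_lie_algebra scale G br \<omega>"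
    and "finite_dimensional scale G"
    and "G \<noteq> {0}"
  shows "symplectic_poisson_algebra scale G br \<omega> \<longleftrightarrow>
    (\<exists>(H :: 'a set) brH \<omega>H D z.
       symplectic_poisson_algebra scale H brH \<omega>H \<and>
       finite_dimensional scale H \<and>
       vector_space.dim scale H + 2 = vector_space.dim scale G \<and>
       admissible scale H brH \<omega>H D z \<and>
       symplectic_double_extension scale G br \<omega> scale H brH \<omega>H D z)"
proof
  assume P: "symplectic_poisson_algebra scale G br \<omega>"
  then interpret P: symplectic_poisson_algebra scale G br \<omega> .
  have "\<exists>e. e \<in> lie_center G br \<and> e \<noteq> 0"
  proof (cases "\<exists>u\<in>G. \<exists>v\<in>G. br u v \<noteq> 0")
    case True
    then obtain u v where "u \<in> G" "v \<in> G" "br u v \<noteq> 0" by blast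
    then show ?thesis
      using P.two_nilpotent by (intro exI[of _ "br u v"]) (simp add: lie_center_def)
  next
    case False
    then show ?thesis using assms(3) P.carrier_closed(1) by (auto simp: lie_center_def)
  qed
  then obtain e where e: "e \<in> lie_center G br" "e \<noteq> 0" by blast
  obtain H brH D z d where ext: "symplectic_double_ext scale G br \<omega> scale H brH \<omega> D z e d (\<lambda>x. x)"
    and dim: "vector_space.dim scale H + 2 = vector_space.dim scale G"
    using double_extension_by_central_element[OF assms(1,2) e] .
  interpret symplectic_double_ext scale G br \<omega> scale H brH \<omega> D z e d "\<lambda>x. x" by fact
  show "\<exists>(H :: 'a set) brH \<omega>H D z.
       symplectic_poisson_algebra scale H brH \<omega>H \<and>
       finite_dimensional scale H \<and>
       vector_space.dim scale H + 2 = vector_space.dim scale G \<and>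
       admissible scale H brH \<omega>H D z \<and>
       symplectic_double_extension scale G br \<omega> scale H brH \<omega>H D z"
    using poisson_imp_admissible[OF P] fin_dim dim double_extension by blast
next
  assume "\<exists>(H :: 'a set) brH \<omega>H D z.
       symplectic_poisson_algebra scale H brH \<omega>H \<and>
       finite_dimensional scale H \<and>
       vector_space.dim scale H + 2 = vector_space.dim scale G \<and>
       admissible scale H brH \<omega>H D z \<and>
       symplectic_double_extension scale G br \<omega> scale H brH \<omega>H D z"
  then show "symplectic_poisson_algebra scale G br \<omega>"
    by (meson symplectic_double_extensionE symplectic_double_ext.admissible_imp_poisson)
qed

end
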